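(* Let $(W,S)$ be a Coxeter system and let $\mathscr I\subseteq W$ be a nonempty $W$-graph ideal with respect to $J\subseteq\mathrm{Pos}(\mathscr I)$, with $W$-graph basis $C=\{c_w\mid w\in\mathscr I\}$ of $\mathscr S(\mathscr I,J)$ and corresponding $W$-graph $\Gamma=\Gamma(C)$. Let $\mathscr C$ be the set of cells of $\Gamma$ and let $\mathcal C_1\in\mathscr C$ be the cell that contains $c_1$. Then $\mathcal C_1$ is the unique maximal element of the partially ordered set $(\mathscr C,\le_\Gamma)$.
   Context: **Hecke algebra.** $(W,S)$ is a Coxeter system with length function $l$, Bruhat order $\le$, and left weak order $\le_L$ ($u\le_L w$ iff $l(w)=l(wu^{-1})+l(u)$, i.e. $u$ is a suffix of $w$). $\mathcal A=\mathbb Z[q,q^{-1}]$, $\mathcal A^+=\mathbb Z[q]$. $\mathcal H$ is the associative $\mathcal A$-algebra generated by $T_s$ ($s\in S$) with $T_s^2=1+(q-q^{-1})T_s$ and the braid relations. The involution $a\mapsto\overline a$ of $\mathcal A$ with $\overline q=q^{-1}$ extends to a ring involution of $\mathcal H$ with $\overline{T_s}=T_s^{-1}$. **$W$-graphs and cells.** A $W$-graph is a triple $\Gamma=(V,\mu,\tau)$, with $V$ a set, $\mu\colon V\times V\to\mathbb Z$, and $\tau$ a map from $V$ to the power set of $S$, such that the free $\mathcal A$-module on $V$ is an $\mathcal H$-module via $T_sv=-q^{-1}v$ if $s\in\tau(v)$ and $T_sv=qv+\sum_{u\in V,\,s\in\tau(u)}\mu(u,v)u$ if $s\notin\tau(v)$.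 The preorder $\le_\Gamma$ on $V$ is the reflexive transitive closure of the relation $u\leftarrow_\Gamma v$ defined by $\tau(u)\nsubseteq\tau(v)$ and $\mu(u,v)\neq0$. The cells of $\Gamma$ are the classes of the associated equivalence relation, partially ordered by $\mathcal C\le_\Gamma\mathcal C'$ iff $u\le_\Gamma v$ for some (equivalently all) $u\in\mathcal C$, $v\in\mathcal C'$. **$W$-graph ideals.** For $J\subseteq S$, $D_J=\{w\in W\mid l(ws)>l(w)\text{ for all }s\in J\}$; $\mathrm{Pos}(X)=\{s\in S\mid l(xs)>l(x)\text{ for all }x\in X\}$. An ideal of $(W,\le_L)$ is a subset $\mathscr I\subseteq W$ containing every suffix of each of its elements. Let $\mathscr I$ be a nonempty ideal and $J\subseteq\mathrm{Pos}(\mathscr I)$. For $w\in\mathscr I$ put $\mathrm{SA}(w)=\{s\in S\mid sw>w,\ sw\in\mathscr I\}$, $\mathrm{SD}(w)=\{s\in S\mid sw<w\}$, $\mathrm{WA}(w)=\{s\in S\mid sw>w,\ sw\in D_J\setminus\mathscr I\}$, $\mathrm{WD}(w)=\{s\in S\mid sw>w,\ sw\notin D_J\}$, and $\mathrm D(w)=\mathrm{SD}(w)\cup\mathrm{WD}(w)$. $\mathscr I$ is a $W$-graph ideal with respect to $J$ if: (i) there is an $\mathcal A$-free $\mathcal H$-module $\mathscr S(\mathscr I,J)$ with $\mathcal A$-basis $(b_w\mid w\in\mathscr I)$ such that $T_sb_w=b_{sw}$ if $s\in\mathrm{SA}(w)$; $T_sb_w=b_{sw}+(q-q^{-1})b_w$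 if $s\in\mathrm{SD}(w)$; $T_sb_w=-q^{-1}b_w$ if $s\in\mathrm{WD}(w)$; $T_sb_w=qb_w-\sum_{y\in\mathscr I,\,y<sw}r^s_{y,w}b_y$ for some $r^s_{y,w}\in q\mathcal A^+$ if $s\in\mathrm{WA}(w)$; (ii) this module admits an $\mathcal A$-semilinear involution $\alpha\mapsto\overline\alpha$ with $\overline{b_1}=b_1$ and $\overline{h\alpha}=\overline h\,\overline\alpha$ for all $h\in\mathcal H$ and all $\alpha$ in the module. **Associated $W$-graph (known).** If $\mathscr I$ is a $W$-graph ideal with respect to $J$, then $\mathscr S(\mathscr I,J)$ has a unique $\mathcal A$-basis $C=(c_w\mid w\in\mathscr I)$ (the $W$-graph basis) with $\overline{c_w}=c_w$ and $b_w=c_w+q\sum_{y\in\mathscr I,\,y<w}q_{y,w}c_y$, $q_{y,w}\in\mathcal A^+$. Let $\mu_{y,w}$ be the constant term of $q_{y,w}$. Put $\mu(c_y,c_w)=\mu_{y,w}$ if $y<w$, $\mu_{w,y}$ if $w<y$, and $0$ otherwise, and $\tau(c_w)=\mathrm D(w)$. Then $\Gamma(C)=(C,\mu,\tau)$ is a $W$-graph. *)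

theory Defs
  imports
    "HOL-Algebra.Multiplicative_Group"
    "HOL-Algebra.Generated_Groups"
    "HOL-Algebra.QuotRing"
    "HOL-Library.Poly_Mapping"
begin

section \<open>Coxeter systems\<close>

definition word_prod :: "('w, 'r) monoid_scheme \<Rightarrow> 'w list \<Rightarrow> 'w" where
  "word_prod W ws = foldr (mult W) ws (one W)"

text \<open>One rewriting step by a defining relation \<open>(st)\<^bsup>m(s,t)\<^esup> = 1\<close>, where \<open>m(s,t)\<close> is the order of
  \<open>st\<close> in \<open>W\<close>. The function \<^const>\<open>group.ord\<close> is 0 on elements of infinite order, so in that case the
  relation is void. The instance \<open>s = t\<close> is \<open>ss = 1\<close>, hence words without formal inverses suffice.\<close>

inductive cox_step :: "('w, 'r) monoid_scheme \<Rightarrow> 'w set \<Rightarrow> 'w list \<Rightarrow> 'w list \<Rightarrow> bool"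
  for W S where
  "us \<in> lists S \<Longrightarrow> vs \<in> lists S \<Longrightarrow> s \<in> S \<Longrightarrow> t \<in> S \<Longrightarrow>
     cox_step W S (us @ concat (replicate (group.ord W (s \<otimes>\<^bsub>W\<^esub> t)) [s, t]) @ vs) (us @ vs)"

locale coxeter_system = group W for W :: "('w, 'r) monoid_scheme" (structure) +
  fixes S :: "'w set"
  assumes S_carrier: "S \<subseteq> carrier W"
    and S_order_two: "s \<in> S \<Longrightarrow> s \<noteq> \<one> \<and> s \<otimes> s = \<one>"
    and S_generates: "generate W S = carrier W"
    and presentation: "ws \<in> lists S \<Longrightarrow> vs \<in> lists S \<Longrightarrow> word_prod W ws = word_prod W vs \<Longrightarrow>
          equivclp (cox_step W S) ws vs"

definition cox_length :: "('w, 'r) monoid_scheme \<Rightarrow> 'w set \<Rightarrow> 'w \<Rightarrow> nat" where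
  "cox_length W S w = (LEAST n. \<exists>ws \<in> lists S. length ws = n \<and> word_prod W ws = w)"

definition reflections :: "('w, 'r) monoid_scheme \<Rightarrow> 'w set \<Rightarrow> 'w set" where
  "reflections W S = {x \<otimes>\<^bsub>W\<^esub> s \<otimes>\<^bsub>W\<^esub> inv\<^bsub>W\<^esub> x | x s. x \<in> carrier W \<and> s \<in> S}"

definition bruhat_step :: "('w, 'r) monoid_scheme \<Rightarrow> 'w set \<Rightarrow> 'w \<Rightarrow> 'w \<Rightarrow> bool" where
  "bruhat_step W S u w \<longleftrightarrow> u \<in> carrier W \<and> (\<exists>t \<in> reflections W S. w = u \<otimes>\<^bsub>W\<^esub> t) \<and>
     cox_length W S u < cox_length W S w"

definition bruhat_le :: "('w, 'r) monoid_scheme \<Rightarrow> 'w set \<Rightarrow> 'w \<Rightarrow> 'w \<Rightarrow> bool" where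
  "bruhat_le W S = (bruhat_step W S)\<^sup>*\<^sup>*"

definition bruhat_less :: "('w, 'r) monoid_scheme \<Rightarrow> 'w set \<Rightarrow> 'w \<Rightarrow> 'w \<Rightarrow> bool" where
  "bruhat_less W S u w \<longleftrightarrow> bruhat_le W S u w \<and> u \<noteq> w"

definition left_weak_le :: "('w, 'r) monoid_scheme \<Rightarrow> 'w set \<Rightarrow> 'w \<Rightarrow> 'w \<Rightarrow> bool" where
  "left_weak_le W S u w \<longleftrightarrow>
     cox_length W S w = cox_length W S (w \<otimes>\<^bsub>W\<^esub> inv\<^bsub>W\<^esub> u) + cox_length W S u"

definition weak_order_ideal :: "('w, 'r) monoid_scheme \<Rightarrow> 'w set \<Rightarrow> 'w set \<Rightarrow> bool" where
  "weak_order_ideal W S I \<longleftrightarrow> I \<subseteq> carrier W \<and>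
     (\<forall>w \<in> I. \<forall>u \<in> carrier W. left_weak_le W S u w \<longrightarrow> u \<in> I)"

definition min_coset_reps :: "('w, 'r) monoid_scheme \<Rightarrow> 'w set \<Rightarrow> 'w set \<Rightarrow> 'w set" where
  "min_coset_reps W S J =
     {w \<in> carrier W. \<forall>s \<in> J. cox_length W S (w \<otimes>\<^bsub>W\<^esub> s) > cox_length W S w}"

definition Pos :: "('w, 'r) monoid_scheme \<Rightarrow> 'w set \<Rightarrow> 'w set \<Rightarrow> 'w set" where
  "Pos W S X = {s \<in> S. \<forall>x \<in> X. cox_length W S (x \<otimes>\<^bsub>W\<^esub> s) > cox_length W S x}"


section \<open>Laurent polynomials over the integers\<close>

text \<open>\<open>\<int>[q, q\<^sup>-\<^sup>1]\<close> as the group ring of \<open>(\<int>, +)\<close>, with the convolution product of \<^typ>\<open>int \<Rightarrow>\<^sub>0 int\<close>;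
  the coefficient of \<open>q\<^sup>k\<close> in \<open>a\<close> is \<open>Poly_Mapping.lookup a k\<close>.\<close>

type_synonym laurent = "int \<Rightarrow>\<^sub>0 int"

definition qq :: laurent where "qq = Poly_Mapping.single 1 1"
definition qinv :: laurent where "qinv = Poly_Mapping.single (- 1) 1"

definition laurent_bar :: "laurent \<Rightarrow> laurent" where
  "laurent_bar = Poly_Mapping.map_key uminus"

definition Aplus :: "laurent set" where
  "Aplus = {a. \<forall>k \<in> Poly_Mapping.keys a. 0 \<le> k}"

definition const_term :: "laurent \<Rightarrow> int" where
  "const_term a = Poly_Mapping.lookup a 0"


section \<open>The Hecke algebra\<close>

datatype 'a free_monoid = Word (letters: "'a list")

instantiation free_monoid :: (type) monoid_add
begin
definition "0 = Word []"
definition "u + v = Word (letters u @ letters v)"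
instance
  by standard (simp_all add: zero_free_monoid_def plus_free_monoid_def)
end

text \<open>The free associative algebra over \<^typ>\<open>laurent\<close> on generators indexed by \<open>S\<close>: the multiplication
  of \<^typ>\<open>'a free_monoid \<Rightarrow>\<^sub>0 laurent\<close> is convolution with respect to concatenation of words.\<close>

type_synonym 'a free_alg = "'a free_monoid \<Rightarrow>\<^sub>0 laurent"

definition free_algebra :: "'a set \<Rightarrow> 'a free_alg ring" where
  "free_algebra S = \<lparr> carrier = {f. \<forall>u \<in> Poly_Mapping.keys f. letters u \<in> lists S},
     mult = (*), one = 1, zero = 0, add = (+) \<rparr>"

definition free_word :: "'a list \<Rightarrow> 'a free_alg" where
  "free_word ws = Poly_Mapping.single (Word ws) 1"

definition free_const :: "laurent \<Rightarrow> 'a free_alg" where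
  "free_const p = Poly_Mapping.single (Word []) p"

fun alt_word :: "'a \<Rightarrow> 'a \<Rightarrow> nat \<Rightarrow> 'a list" where
  "alt_word s t 0 = []"
| "alt_word s t (Suc n) = s # alt_word t s n"

definition hecke_relators :: "('w, 'r) monoid_scheme \<Rightarrow> 'w set \<Rightarrow> 'w free_alg set" where
  "hecke_relators W S =
     {free_word [s, s] - (1 + free_const (qq - qinv) * free_word [s]) | s. s \<in> S} \<union>
     {free_word (alt_word s t m) - free_word (alt_word t s m) | s t m.
        s \<in> S \<and> t \<in> S \<and> s \<noteq> t \<and> m = group.ord W (s \<otimes>\<^bsub>W\<^esub> t) \<and> m \<noteq> 0}"

definition hecke_ideal :: "('w, 'r) monoid_scheme \<Rightarrow> 'w set \<Rightarrow> 'w free_alg set" where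
  "hecke_ideal W S = genideal (free_algebra S) (hecke_relators W S)"

definition hecke_algebra :: "('w, 'r) monoid_scheme \<Rightarrow> 'w set \<Rightarrow> 'w free_alg set ring" where
  "hecke_algebra W S = free_algebra S Quot hecke_ideal W S"

definition hecke_T :: "('w, 'r) monoid_scheme \<Rightarrow> 'w set \<Rightarrow> 'w \<Rightarrow> 'w free_alg set" where
  "hecke_T W S s = hecke_ideal W S +>\<^bsub>free_algebra S\<^esub> free_word [s]"

definition hecke_const :: "('w, 'r) monoid_scheme \<Rightarrow> 'w set \<Rightarrow> laurent \<Rightarrow> 'w free_alg set" where
  "hecke_const W S p = hecke_ideal W S +>\<^bsub>free_algebra S\<^esub> free_const p"

text \<open>These conditions determine the values of \<open>\<beta>\<close> on the carrier, since the \<open>T\<^sub>s\<close> and the scalars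
  generate the Hecke algebra as a ring.\<close>

definition hecke_involution ::
  "('w, 'r) monoid_scheme \<Rightarrow> 'w set \<Rightarrow> ('w free_alg set \<Rightarrow> 'w free_alg set) \<Rightarrow> bool" where
  "hecke_involution W S \<beta> \<longleftrightarrow>
     \<beta> \<in> ring_hom (hecke_algebra W S) (hecke_algebra W S) \<and>
     (\<forall>h \<in> carrier (hecke_algebra W S). \<beta> (\<beta> h) = h) \<and>
     (\<forall>p. \<beta> (hecke_const W S p) = hecke_const W S (laurent_bar p)) \<and>
     (\<forall>s \<in> S. \<beta> (hecke_T W S s) = inv\<^bsub>hecke_algebra W S\<^esub> (hecke_T W S s))"

text \<open>HOL-Algebra's \<^locale>\<open>Module.module\<close> is restricted to commutative rings.\<close>

definition left_module :: "('h, 'r) ring_scheme \<Rightarrow> ('h \<Rightarrow> 'm \<Rightarrow> 'm :: ab_group_add) \<Rightarrow> bool" where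
  "left_module R act \<longleftrightarrow>
     (\<forall>x. act \<one>\<^bsub>R\<^esub> x = x) \<and>
     (\<forall>h \<in> carrier R. \<forall>x y. act h (x + y) = act h x + act h y) \<and>
     (\<forall>h \<in> carrier R. \<forall>k \<in> carrier R. \<forall>x. act (h \<oplus>\<^bsub>R\<^esub> k) x = act h x + act k x) \<and>
     (\<forall>h \<in> carrier R. \<forall>k \<in> carrier R. \<forall>x. act (h \<otimes>\<^bsub>R\<^esub> k) x = act h (act k x))"


section \<open>\<open>W\<close>-graphs and cells\<close>

record ('v, 's) wgraph =
  verts :: "'v set"
  mu :: "'v \<Rightarrow> 'v \<Rightarrow> int"
  tau :: "'v \<Rightarrow> 's set"

text \<open>\<open>wg_arrow \<Gamma> u v\<close> is \<open>u \<leftarrow>\<^sub>\<Gamma> v\<close>.\<close>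

definition wg_arrow :: "('v, 's) wgraph \<Rightarrow> 'v \<Rightarrow> 'v \<Rightarrow> bool" where
  "wg_arrow \<Gamma> u v \<longleftrightarrow> u \<in> verts \<Gamma> \<and> v \<in> verts \<Gamma> \<and> \<not> tau \<Gamma> u \<subseteq> tau \<Gamma> v \<and> mu \<Gamma> u v \<noteq> 0"

definition wg_le :: "('v, 's) wgraph \<Rightarrow> 'v \<Rightarrow> 'v \<Rightarrow> bool" where
  "wg_le \<Gamma> = (wg_arrow \<Gamma>)\<^sup>*\<^sup>*"

definition wg_equiv :: "('v, 's) wgraph \<Rightarrow> ('v \<times> 'v) set" where
  "wg_equiv \<Gamma> = {(u, v). u \<in> verts \<Gamma> \<and> v \<in> verts \<Gamma> \<and> wg_le \<Gamma> u v \<and> wg_le \<Gamma> v u}"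

definition wg_cells :: "('v, 's) wgraph \<Rightarrow> 'v set set" where
  "wg_cells \<Gamma> = verts \<Gamma> // wg_equiv \<Gamma>"

definition cell_le :: "('v, 's) wgraph \<Rightarrow> 'v set \<Rightarrow> 'v set \<Rightarrow> bool" where
  "cell_le \<Gamma> C C' \<longleftrightarrow> (\<exists>u \<in> C. \<exists>v \<in> C'. wg_le \<Gamma> u v)"

definition maximal_cell :: "('v, 's) wgraph \<Rightarrow> 'v set \<Rightarrow> bool" where
  "maximal_cell \<Gamma> C \<longleftrightarrow> C \<in> wg_cells \<Gamma> \<and> (\<forall>C' \<in> wg_cells \<Gamma>. cell_le \<Gamma> C C' \<longrightarrow> C' = C)"


section \<open>\<open>W\<close>-graph ideals\<close>

text \<open>Ascents and descents of \<open>w\<close> relative to an ideal \<open>I\<close> and a set \<open>J\<close>\<close>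

definition SA :: "('w, 'r) monoid_scheme \<Rightarrow> 'w set \<Rightarrow> 'w set \<Rightarrow> 'w \<Rightarrow> 'w set" where
  "SA W S I w = {s \<in> S. bruhat_less W S w (s \<otimes>\<^bsub>W\<^esub> w) \<and> s \<otimes>\<^bsub>W\<^esub> w \<in> I}"

definition SD :: "('w, 'r) monoid_scheme \<Rightarrow> 'w set \<Rightarrow> 'w \<Rightarrow> 'w set" where
  "SD W S w = {s \<in> S. bruhat_less W S (s \<otimes>\<^bsub>W\<^esub> w) w}"

definition WA :: "('w, 'r) monoid_scheme \<Rightarrow> 'w set \<Rightarrow> 'w set \<Rightarrow> 'w set \<Rightarrow> 'w \<Rightarrow> 'w set" where
  "WA W S I J w =
     {s \<in> S. bruhat_less W S w (s \<otimes>\<^bsub>W\<^esub> w) \<and> s \<otimes>\<^bsub>W\<^esub> w \<in> min_coset_reps W S J - I}"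

definition WD :: "('w, 'r) monoid_scheme \<Rightarrow> 'w set \<Rightarrow> 'w set \<Rightarrow> 'w \<Rightarrow> 'w set" where
  "WD W S J w = {s \<in> S. bruhat_less W S w (s \<otimes>\<^bsub>W\<^esub> w) \<and> s \<otimes>\<^bsub>W\<^esub> w \<notin> min_coset_reps W S J}"

definition Desc :: "('w, 'r) monoid_scheme \<Rightarrow> 'w set \<Rightarrow> 'w set \<Rightarrow> 'w \<Rightarrow> 'w set" where
  "Desc W S J w = SD W S w \<union> WD W S J w"

text \<open>An ideal \<open>I\<close> is a \<open>W\<close>-graph ideal with respect to \<open>J\<close> iff the data \<open>act\<close>, \<open>b\<close>, \<open>mbar\<close> below
  exist. They are locale parameters rather than existentially quantified because the \<open>W\<close>-graph basis
  lives in the module. The scalar action is the restriction of \<open>act\<close> to constants.\<close>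

definition scal :: "('w, 'r) monoid_scheme \<Rightarrow> 'w set \<Rightarrow> ('w free_alg set \<Rightarrow> 'm \<Rightarrow> 'm) \<Rightarrow>
    laurent \<Rightarrow> 'm \<Rightarrow> 'm" where
  "scal W S act p = act (hecke_const W S p)"

locale W_graph_ideal =
  fixes W :: "('w, 'r) monoid_scheme" (structure)
    and S I J :: "'w set"
    and hbar :: "'w free_alg set \<Rightarrow> 'w free_alg set"
    and act :: "'w free_alg set \<Rightarrow> 'm \<Rightarrow> 'm :: ab_group_add"
    and b :: "'w \<Rightarrow> 'm"
    and mbar :: "'m \<Rightarrow> 'm"
  assumes hecke_module: "left_module (hecke_algebra W S) act"
    and basis_inj: "inj_on b I"
    and basis_independent: "\<not> Modules.module.dependent (scal W S act) (b ` I)"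
    and basis_span: "Modules.module.span (scal W S act) (b ` I) = UNIV"
    and T_SA: "w \<in> I \<Longrightarrow> s \<in> SA W S I w \<Longrightarrow> act (hecke_T W S s) (b w) = b (s \<otimes> w)"
    and T_SD: "w \<in> I \<Longrightarrow> s \<in> SD W S w \<Longrightarrow>
          act (hecke_T W S s) (b w) = b (s \<otimes> w) + scal W S act (qq - qinv) (b w)"
    and T_WD: "w \<in> I \<Longrightarrow> s \<in> WD W S J w \<Longrightarrow>
          act (hecke_T W S s) (b w) = scal W S act (- qinv) (b w)"
    and T_WA: "w \<in> I \<Longrightarrow> s \<in> WA W S I J w \<Longrightarrow>
          \<exists>r. (\<forall>y. r y \<in> (*) qq ` Aplus) \<and>
            act (hecke_T W S s) (b w) = scal W S act qq (b w)
              - (\<Sum>y | y \<in> I \<and> bruhat_less W S y (s \<otimes> w). scal W S act (r y) (b y))"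
    and mbar_mbar: "mbar (mbar x) = x"
    and mbar_add: "mbar (x + y) = mbar x + mbar y"
    and mbar_scal: "mbar (scal W S act p x) = scal W S act (laurent_bar p) (mbar x)"
    and mbar_b_one: "mbar (b \<one>) = b \<one>"
    and mbar_act: "h \<in> carrier (hecke_algebra W S) \<Longrightarrow> mbar (act h x) = act (hbar h) (mbar x)"

text \<open>\<open>p y w\<close> is \<open>q\<^bsub>y,w\<^esub>\<close>; only its values at \<open>y, w \<in> I\<close> with \<open>y < w\<close> are relevant.\<close>

locale W_graph_basis =
  fixes W :: "('w, 'r) monoid_scheme" (structure)
    and S I :: "'w set"
    and act :: "'w free_alg set \<Rightarrow> 'm \<Rightarrow> 'm :: ab_group_add"
    and b :: "'w \<Rightarrow> 'm"
    and mbar :: "'m \<Rightarrow> 'm"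
    and c :: "'w \<Rightarrow> 'm"
    and p :: "'w \<Rightarrow> 'w \<Rightarrow> laurent"
  assumes c_inj: "inj_on c I"
    and c_independent: "\<not> Modules.module.dependent (scal W S act) (c ` I)"
    and c_span: "Modules.module.span (scal W S act) (c ` I) = UNIV"
    and mbar_c: "w \<in> I \<Longrightarrow> mbar (c w) = c w"
    and p_Aplus: "y \<in> I \<Longrightarrow> w \<in> I \<Longrightarrow> bruhat_less W S y w \<Longrightarrow> p y w \<in> Aplus"
    and b_eq: "w \<in> I \<Longrightarrow>
          b w = c w + scal W S act qq
            (\<Sum>y | y \<in> I \<and> bruhat_less W S y w. scal W S act (p y w) (c y))"

definition W_graph_of :: "('w, 'r) monoid_scheme \<Rightarrow> 'w set \<Rightarrow> 'w set \<Rightarrow> 'w set \<Rightarrow>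
    ('w \<Rightarrow> 'm) \<Rightarrow> ('w \<Rightarrow> 'w \<Rightarrow> laurent) \<Rightarrow> ('m, 'w) wgraph" where
  "W_graph_of W S I J c p =
     \<lparr> verts = c ` I,
       mu = (\<lambda>u v. let y = the_inv_into I c u; w = the_inv_into I c v in
          if bruhat_less W S y w then const_term (p y w)
          else if bruhat_less W S w y then const_term (p w y)
          else 0),
       tau = (\<lambda>u. Desc W S J (the_inv_into I c u)) \<rparr>"

end

theory Submission
  imports Defs
begin

text \<open>
  It suffices to find, for every \<open>w \<noteq> 1\<close> in the ideal, some \<open>v\<close> in the ideal with \<open>l(v) < l(w)\<close> and
  \<open>c\<^sub>w \<leftarrow> c\<^sub>v\<close>; then \<open>c\<^sub>w \<le>\<^sub>\<Gamma> c\<^sub>1\<close> by induction. Write \<open>w = sv\<close> with \<open>l(w) = l(v) + 1\<close>. Then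
  \<open>s \<in> D(w) - D(v)\<close>, and it remains to see that the constant term of \<open>q\<^bsub>v,w\<^esub>\<close> is 1. Let \<open>g\<close> be the
  coefficient of \<open>c\<^sub>w\<close> in \<open>T\<^sub>s c\<^sub>w\<close>. For \<open>l(y) < l(w)\<close> the coefficient of \<open>c\<^sub>w\<close> in \<open>T\<^sub>s c\<^sub>y\<close> is 1 if
  \<open>y = v\<close> and 0 otherwise, so expanding \<open>T\<^sub>s b\<^sub>w = b\<^sub>v + (q - q\<^sup>-\<^sup>1) b\<^sub>w\<close> in the basis \<open>C\<close> gives
  \<open>g = q - q\<^sup>-\<^sup>1 - q q\<^bsub>v,w\<^esub>\<close>. On the other hand the bar of \<open>g\<close> is \<open>g - (q - q\<^sup>-\<^sup>1)\<close>, because \<open>c\<^sub>w\<close> is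
  bar-invariant and the bar of \<open>T\<^sub>s\<close> is \<open>T\<^sub>s - (q - q\<^sup>-\<^sup>1)\<close>. Comparing coefficients of \<open>q\<close> yields the claim.
\<close>

section \<open>Words, parity and length in a Coxeter group\<close>

lemma word_prod_simps [simp]:
  "word_prod W [] = \<one>\<^bsub>W\<^esub>" "word_prod W (x # ws) = x \<otimes>\<^bsub>W\<^esub> word_prod W ws"
  by (simp_all add: word_prod_def)

text \<open>A deleted block repeats the two letters \<open>s, t\<close>, so its length is even for
  every value of the order, 0 included.\<close>

lemma cox_step_even_length:
  assumes "cox_step W S us vs"
  shows "even (length us) \<longleftrightarrow> even (length vs)"
  using assms by cases (auto simp: length_concat sum_list_replicate)

lemma equivclp_cox_step_even_length:
  assumes "equivclp (cox_step W S) us vs"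
  shows "even (length us) \<longleftrightarrow> even (length vs)"
  using assms
  by (induction rule: equivclp_induct) (auto dest: cox_step_even_length)

context coxeter_system
begin

lemma word_prod_closed: "ws \<in> lists S \<Longrightarrow> word_prod W ws \<in> carrier W"
  using S_carrier by (induction ws) auto

lemma word_prod_append:
  "us \<in> lists S \<Longrightarrow> vs \<in> lists S \<Longrightarrow> word_prod W (us @ vs) = word_prod W us \<otimes> word_prod W vs"
proof (induction us)
  case (Cons a us)
  then have "a \<in> carrier W" "word_prod W us \<in> carrier W" "word_prod W vs \<in> carrier W"
    using S_carrier word_prod_closed by auto
  with Cons show ?case by (simp add: m_assoc)
qed (simp add: word_prod_closed)

lemma inv_generator: "s \<in> S \<Longrightarrow> inv s = s"
  using S_order_two S_carrier by (auto intro: inv_equality)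

lemma ex_word:
  assumes "w \<in> carrier W"
  shows "\<exists>ws \<in> lists S. word_prod W ws = w"
proof -
  have "w \<in> generate W S" using assms S_generates by simp
  then show ?thesis
  proof induction
    case one
    show ?case by (rule bexI[of _ "[]"]) auto
  next
    case (incl s)
    then show ?case using S_carrier by (intro bexI[of _ "[s]"]) auto
  next
    case (inv s)
    then show ?case using S_carrier by (intro bexI[of _ "[s]"]) (auto simp: inv_generator)
  next
    case (eng u v)
    then show ?case by (metis word_prod_append append_in_lists_conv)
  qed
qed

lemma ex_reduced_word:
  assumes "w \<in> carrier W"
  shows "\<exists>ws \<in> lists S. length ws = cox_length W S w \<and> word_prod W ws = w"
  unfolding cox_length_def by (rule LeastI_ex) (use ex_word[OF assms] in auto)

lemma cox_length_word_prod_le: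
  "ws \<in> lists S \<Longrightarrow> cox_length W S (word_prod W ws) \<le> length ws"
  unfolding cox_length_def by (rule Least_le) auto

text \<open>Words for the same element are linked by relation steps, which preserve the parity of
  the number of letters. This is the sign character of \<open>W\<close> expressed through
  words.\<close>

lemma even_cox_length_word_prod:
  assumes "ws \<in> lists S"
  shows "even (cox_length W S (word_prod W ws)) \<longleftrightarrow> even (length ws)"
proof -
  obtain vs where "vs \<in> lists S" "length vs = cox_length W S (word_prod W ws)"
      "word_prod W vs = word_prod W ws"
    using ex_reduced_word[OF word_prod_closed[OF assms]] by auto
  then show ?thesis
    using assms presentation[of vs ws] equivclp_cox_step_even_length[of W S vs ws] by simp
qed

lemma cox_length_generator_mult_le:
  assumes "s \<in> S" "w \<in> carrier W"
  shows "cox_length W S (s \<otimes> w) \<le> Suc (cox_length W S w)"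
proof -
  obtain ws where "ws \<in> lists S" "length ws = cox_length W S w" "word_prod W ws = w"
    using ex_reduced_word[OF assms(2)] by auto
  then show ?thesis using cox_length_word_prod_le[of "s # ws"] assms(1) by simp
qed

text \<open>Prefixing one letter flips the parity, which leaves only strict ascent or strict
  descent.\<close>

lemma cox_length_generator_mult_neq:
  assumes "s \<in> S" "w \<in> carrier W"
  shows "cox_length W S (s \<otimes> w) \<noteq> cox_length W S w"
proof -
  obtain ws where "ws \<in> lists S" "length ws = cox_length W S w" "word_prod W ws = w"
    using ex_reduced_word[OF assms(2)] by auto
  then show ?thesis using even_cox_length_word_prod[of "s # ws"] assms(1) by auto
qed

lemma cox_length_generator: "s \<in> S \<Longrightarrow> cox_length W S s = 1"
proof -
  assume s: "s \<in> S"
  have "cox_length W S \<one> = 0" using cox_length_word_prod_le[of "[]"] by simp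
  moreover have "s \<otimes> \<one> = s" using s S_carrier by auto
  ultimately show ?thesis
    using cox_length_generator_mult_le[of s \<one>] cox_length_generator_mult_neq[of s \<one>] s by auto
qed

lemma generator_mult_generator_mult:
  "s \<in> S \<Longrightarrow> w \<in> carrier W \<Longrightarrow> s \<otimes> (s \<otimes> w) = w"
  using S_order_two[of s] S_carrier by (auto simp flip: m_assoc)

text \<open>The first letter of a reduced word is split off. The remaining word is again reduced,
  since a shorter word for \<open>v\<close> would give a shorter one for \<open>w\<close>.\<close>

lemma left_descent:
  assumes "w \<in> carrier W" "w \<noteq> \<one>"
  obtains s v where "s \<in> S" "v \<in> carrier W" "w = s \<otimes> v"
    "cox_length W S w = Suc (cox_length W S v)"
proof -
  obtain ws where ws: "ws \<in> lists S" "length ws = cox_length W S w" "word_prod W ws = w"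
    using ex_reduced_word[OF assms(1)] by auto
  with assms(2) obtain s vs where "ws = s # vs" by (cases ws) auto
  with ws have *: "s \<in> S" "vs \<in> lists S" "w = s \<otimes> word_prod W vs"
      "cox_length W S w = Suc (length vs)" by auto
  have "cox_length W S w \<le> Suc (cox_length W S (word_prod W vs))"
    using *(1,3) cox_length_generator_mult_le[OF *(1) word_prod_closed[OF *(2)]] by simp
  with * cox_length_word_prod_le[of vs]
  have "cox_length W S w = Suc (cox_length W S (word_prod W vs))" by simp
  with * show thesis using that word_prod_closed by blast
qed

section \<open>Bruhat order under left multiplication by a generator\<close>

lemma bruhat_less_cox_length:
  assumes "bruhat_less W S u w"
  shows "cox_length W S u < cox_length W S w"
proof -
  have "(bruhat_step W S)\<^sup>+\<^sup>+ u w"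
    using assms unfolding bruhat_less_def bruhat_le_def by (metis rtranclpD)
  then show ?thesis by induction (auto simp: bruhat_step_def)
qed

text \<open>A \<open>bruhat_step\<close> multiplies by a reflection on the right;
  \<open>s w = w (w^-1 s w)\<close> brings left multiplication into this form.\<close>

lemma bruhat_less_generator_mult:
  assumes "s \<in> S" "w \<in> carrier W" "cox_length W S w < cox_length W S (s \<otimes> w)"
  shows "bruhat_less W S w (s \<otimes> w)"
proof -
  have s: "s \<in> carrier W" using assms S_carrier by auto
  have "s \<otimes> w = w \<otimes> (inv w \<otimes> s \<otimes> inv (inv w))"
    using s assms(2) by (simp add: m_assoc[symmetric])
  moreover have "inv w \<otimes> s \<otimes> inv (inv w) \<in> reflections W S"
    unfolding reflections_def using assms by blast
  ultimately have "bruhat_step W S w (s \<otimes> w)"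
    using assms unfolding bruhat_step_def by blast
  then show ?thesis using assms(3) unfolding bruhat_less_def bruhat_le_def by auto
qed

text \<open>By parity \<open>s\<close> either lowers the length of \<open>w\<close>, which is the
  case SD, or raises it. In the latter case, membership of \<open>s \<otimes> w\<close> in
  \<open>I\<close> and in \<open>min_coset_reps W S J\<close> leaves the three ascending
  classes.\<close>

lemma generator_cases [consumes 3, case_names SA SD WA WD]:
  assumes "s \<in> S" "w \<in> carrier W" "I \<subseteq> carrier W"
  obtains "s \<in> SA W S I w" | "s \<in> SD W S w" | "s \<in> WA W S I J w" | "s \<in> WD W S J w"
proof (cases "cox_length W S w < cox_length W S (s \<otimes> w)")
  case True
  then show ?thesis
    using that assms(1) bruhat_less_generator_mult[OF assms(1,2)]
    unfolding SA_def WA_def WD_def by blast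
next
  case False
  then have "cox_length W S (s \<otimes> w) < cox_length W S w"
    using cox_length_generator_mult_neq[OF assms(1,2)] by linarith
  then have "bruhat_less W S (s \<otimes> w) w"
    using bruhat_less_generator_mult[OF assms(1), of "s \<otimes> w"] assms S_carrier
    by (auto simp: generator_mult_generator_mult)
  then show ?thesis using that assms(1) unfolding SD_def by blast
qed

end

section \<open>The Hecke algebra as a quotient of the free algebra\<close>

lemma free_algebra_simps [simp]:
  "mult (free_algebra S) = (*)" "one (free_algebra S) = 1"
  "zero (free_algebra S) = 0" "add (free_algebra S) = (+)"
  by (simp_all add: free_algebra_def)

lemma free_algebra_closed:
  shows free_algebra_zero_closed: "0 \<in> carrier (free_algebra S)"
    and free_algebra_one_closed: "1 \<in> carrier (free_algebra S)"
    and free_algebra_uminus_closed: "f \<in> carrier (free_algebra S) \<Longrightarrow> - f \<in> carrier (free_algebra S)"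
    and free_algebra_add_closed: "f \<in> carrier (free_algebra S) \<Longrightarrow> g \<in> carrier (free_algebra S) \<Longrightarrow>
      f + g \<in> carrier (free_algebra S)"
    and free_algebra_minus_closed: "f \<in> carrier (free_algebra S) \<Longrightarrow> g \<in> carrier (free_algebra S) \<Longrightarrow>
      f - g \<in> carrier (free_algebra S)"
    and free_algebra_mult_closed: "f \<in> carrier (free_algebra S) \<Longrightarrow> g \<in> carrier (free_algebra S) \<Longrightarrow>
      f * g \<in> carrier (free_algebra S)"
  using keys_add[of f g] keys_diff[of f g] keys_mult[of f g]
  by (fastforce simp: free_algebra_def zero_free_monoid_def plus_free_monoid_def
      simp flip: single_one split: if_splits)+

lemma ring_free_algebra: "ring (free_algebra S)"
proof (rule ringI)
  show "abelian_group (free_algebra S)"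
  proof (rule abelian_groupI)
    fix f assume "f \<in> carrier (free_algebra S)"
    then show "\<exists>g\<in>carrier (free_algebra S). g \<oplus>\<^bsub>free_algebra S\<^esub> f = \<zero>\<^bsub>free_algebra S\<^esub>"
      by (intro bexI[of _ "- f"]) (simp_all add: free_algebra_uminus_closed)
  qed (simp_all add: free_algebra_closed add.assoc add.commute)
  show "Group.monoid (free_algebra S)"
    by (rule monoidI) (simp_all add: free_algebra_closed mult.assoc)
qed (simp_all add: distrib_left distrib_right)

lemma free_word_closed: "ws \<in> lists S \<Longrightarrow> free_word ws \<in> carrier (free_algebra S)"
  by (auto simp: free_algebra_def free_word_def)

lemma free_const_closed: "free_const p \<in> carrier (free_algebra S)"
  by (auto simp: free_algebra_def free_const_def)

lemma free_algebra_a_minus: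
  assumes "f \<in> carrier (free_algebra S)" "g \<in> carrier (free_algebra S)"
  shows "f \<ominus>\<^bsub>free_algebra S\<^esub> g = f - g"
proof -
  interpret ring "free_algebra S" by (rule ring_free_algebra)
  have "- g \<in> carrier (free_algebra S)" using assms by (intro free_algebra_uminus_closed)
  then have "\<ominus>\<^bsub>free_algebra S\<^esub> g = - g" using assms by (intro minus_equality) auto
  then show ?thesis by (simp add: a_minus_def)
qed

lemma set_alt_word: "set (alt_word s t m) \<subseteq> {s, t}"
  by (induction m arbitrary: s t) auto

lemma free_const_simps:
  "free_const 1 = 1" "free_const (p * r) = free_const p * free_const r"
  "free_const (p + r) = free_const p + free_const r"
  by (simp_all add: free_const_def mult_single single_add
      flip: zero_free_monoid_def)

lemma free_const_commute: "free_const p * free_word ws = free_word ws * free_const p"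
  by (simp add: free_const_def free_word_def mult_single flip: zero_free_monoid_def)

lemma hecke_relators_closed: "hecke_relators W S \<subseteq> carrier (free_algebra S)"
proof -
  interpret ring "free_algebra S" by (rule ring_free_algebra)
  have "free_const (qq - qinv) * free_word [s] \<in> carrier (free_algebra S)" if "s \<in> S" for s
    using m_closed[of "free_const (qq - qinv)" "free_word [s]"] that
    by (simp add: free_const_closed free_word_closed)
  then show ?thesis
    using a_closed[OF one_closed]
    by (auto simp: hecke_relators_def intro!: free_algebra_minus_closed free_word_closed
        dest: subsetD[OF set_alt_word])
qed

lemma ideal_hecke_ideal: "ideal (hecke_ideal W S) (free_algebra S)"
  unfolding hecke_ideal_def
  by (rule ring.genideal_ideal[OF ring_free_algebra hecke_relators_closed])

lemma ring_hecke_algebra: "ring (hecke_algebra W S)"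
  unfolding hecke_algebra_def by (rule ideal.quotient_is_ring[OF ideal_hecke_ideal])

text \<open>The quotient map; \<open>hecke_T\<close> and \<open>hecke_const\<close> are its values
  at one-letter words and at constants, so identities in the Hecke algebra reduce to computations in
  the free algebra.\<close>

definition hecke_class :: "('w, 'r) monoid_scheme \<Rightarrow> 'w set \<Rightarrow> 'w free_alg \<Rightarrow> 'w free_alg set" where
  "hecke_class W S f = hecke_ideal W S +>\<^bsub>free_algebra S\<^esub> f"

lemma hecke_class_hom: "hecke_class W S \<in> ring_hom (free_algebra S) (hecke_algebra W S)"
  using ideal.rcos_ring_hom[OF ideal_hecke_ideal]
  unfolding hecke_algebra_def hecke_class_def[abs_def] .

lemmas hecke_class_simps =
  ring_hom_mult[OF hecke_class_hom, simplified] ring_hom_add[OF hecke_class_hom, simplified]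
  ring_hom_one[OF hecke_class_hom, simplified]
lemmas hecke_class_closed = ring_hom_closed[OF hecke_class_hom]

lemma hecke_T_square:
  assumes "s \<in> S"
  shows "hecke_class W S (free_word [s, s]) =
    hecke_class W S (1 + free_const (qq - qinv) * free_word [s])"
proof -
  let ?f = "free_word [s, s]" and ?g = "1 + free_const (qq - qinv) * free_word [s] :: 'a free_alg"
  interpret ring "free_algebra S" by (rule ring_free_algebra)
  have f: "?f \<in> carrier (free_algebra S)" using assms by (auto intro: free_word_closed)
  have g: "?g \<in> carrier (free_algebra S)"
    using a_closed[OF one_closed m_closed[OF free_const_closed free_word_closed[of "[s]"]]] assms by simp
  have "?f - ?g \<in> hecke_relators W S" using assms by (auto simp: hecke_relators_def)
  then have "?f - ?g \<in> hecke_ideal W S"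
    unfolding hecke_ideal_def using genideal_self[OF hecke_relators_closed] by blast
  then show ?thesis
    unfolding hecke_class_def using f g
    by (subst quotient_eq_iff_same_a_r_cos[OF ideal_hecke_ideal, symmetric]) (auto simp: free_algebra_a_minus)
qed

text \<open>The quadratic relation reads \<open>T (T - c) = 1\<close> with
  \<open>c = q - q^-1\<close>; as constants commute with words, the second factor is a two-sided
  inverse.\<close>

lemma inv_hecke_T:
  assumes "s \<in> S"
  shows "inv\<^bsub>hecke_algebra W S\<^esub> (hecke_T W S s) =
    hecke_class W S (free_word [s] - free_const (qq - qinv))"
proof -
  let ?T = "free_word [s] :: 'a free_alg" and ?c = "free_const (qq - qinv) :: 'a free_alg"
  interpret F: ring "free_algebra S" by (rule ring_free_algebra)
  interpret H: ring "hecke_algebra W S" by (rule ring_hecke_algebra)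
  have T: "?T \<in> carrier (free_algebra S)" using assms by (intro free_word_closed) auto
  note c = free_const_closed[of "qq - qinv" S]
  have Tc: "?T - ?c \<in> carrier (free_algebra S)" using T c by (rule free_algebra_minus_closed)
  have cT: "?c * ?T \<in> carrier (free_algebra S)" using F.m_closed[OF c T] assms by simp
  have ncT: "- (?c * ?T) \<in> carrier (free_algebra S)"
    using cT by (auto simp: free_algebra_def)
  have sq: "?T * ?T = free_word [s, s]"
    by (simp add: free_word_def mult_single plus_free_monoid_def)
  \<comment> \<open>The difference is treated as a sum, to which the homomorphism laws apply; the
    class of \<open>?T * ?T\<close> can then be replaced by that of
    \<open>1 + ?c * ?T\<close>.\<close>
  have "hecke_class W S (?T * ?T + - (?c * ?T)) = hecke_class W S (?T * ?T)
      \<oplus>\<^bsub>hecke_algebra W S\<^esub> hecke_class W S (- (?c * ?T))"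
    using F.m_closed[OF T T] assms ncT by (intro hecke_class_simps) auto
  also have "\<dots> = hecke_class W S (1 + ?c * ?T)
      \<oplus>\<^bsub>hecke_algebra W S\<^esub> hecke_class W S (- (?c * ?T))"
    unfolding sq by (simp only: hecke_T_square[OF assms])
  also have "\<dots> = hecke_class W S (1 + ?c * ?T + - (?c * ?T))"
    using F.a_closed[OF F.one_closed cT] ncT by (intro hecke_class_simps(2)[symmetric]) auto
  finally have one: "hecke_class W S (?T * ?T - ?c * ?T) = \<one>\<^bsub>hecke_algebra W S\<^esub>"
    by (simp add: hecke_class_simps)
  have "?T * (?T - ?c) = ?T * ?T - ?c * ?T" "(?T - ?c) * ?T = ?T * ?T - ?c * ?T"
    by (simp_all add: algebra_simps free_const_commute)
  then have "hecke_class W S ?T \<otimes>\<^bsub>hecke_algebra W S\<^esub> hecke_class W S (?T - ?c) = \<one>\<^bsub>hecke_algebra W S\<^esub>"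
     "hecke_class W S (?T - ?c) \<otimes>\<^bsub>hecke_algebra W S\<^esub> hecke_class W S ?T = \<one>\<^bsub>hecke_algebra W S\<^esub>"
    using hecke_class_simps(1)[OF T Tc, of W] hecke_class_simps(1)[OF Tc T, of W] one by simp_all
  then have "inv\<^bsub>hecke_algebra W S\<^esub> (hecke_class W S ?T) = hecke_class W S (?T - ?c)"
    using hecke_class_closed[OF T] hecke_class_closed[OF Tc]
    by (intro H.inv_unique'[symmetric])
  then show ?thesis by (simp add: hecke_T_def hecke_class_def)
qed

section \<open>Coefficients of Laurent polynomials\<close>

lemma lookup_laurent_bar: "Poly_Mapping.lookup (laurent_bar a) k = Poly_Mapping.lookup a (- k)"
  by (simp add: laurent_bar_def map_key.rep_eq)

lemma laurent_bar_add: "laurent_bar (a + a') = laurent_bar a + laurent_bar a'"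
  by (rule poly_mapping_eqI) (simp add: lookup_laurent_bar lookup_add)

lemma lookup_qq_mult: "Poly_Mapping.lookup (qq * a) k = Poly_Mapping.lookup a (k - 1)"
proof -
  have "Poly_Mapping.lookup qq l * x = (x when l = 1)" for l x
    by (simp add: qq_def lookup_single when_def)
  moreover have "k = 1 + l \<longleftrightarrow> l = k - 1" for l by auto
  ultimately show ?thesis by (simp add: lookup_mult)
qed

section \<open>The module over Laurent polynomials and its bar involution\<close>

locale W_graph_ideal_basis =
  coxeter_system W S + W_graph_ideal W S I J hbar act b mbar + W_graph_basis W S I act b mbar c p
  for W :: "('w, 'r) monoid_scheme" (structure) and S I J
    and hbar :: "'w free_alg set \<Rightarrow> 'w free_alg set"
    and act :: "'w free_alg set \<Rightarrow> 'm \<Rightarrow> 'm :: ab_group_add"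
    and b mbar c p +
  assumes hbar: "hecke_involution W S hbar"
    and ideal: "weak_order_ideal W S I"
    and J_subset: "J \<subseteq> Pos W S I"
begin

abbreviation sc :: "laurent \<Rightarrow> 'm \<Rightarrow> 'm" where "sc \<equiv> scal W S act"
abbreviation T :: "'w \<Rightarrow> 'm \<Rightarrow> 'm" where "T s \<equiv> act (hecke_T W S s)"
abbreviation cl :: "'w free_alg \<Rightarrow> 'w free_alg set" where "cl \<equiv> hecke_class W S"

lemma act_right_add: "h \<in> carrier (hecke_algebra W S) \<Longrightarrow> act h (x + y) = act h x + act h y"
  using hecke_module unfolding left_module_def by blast

lemma act_one: "act \<one>\<^bsub>hecke_algebra W S\<^esub> x = x"
  using hecke_module unfolding left_module_def by blast

lemma act_class_add:
  assumes "f \<in> carrier (free_algebra S)" "g \<in> carrier (free_algebra S)"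
  shows "act (cl (f + g)) x = act (cl f) x + act (cl g) x"
  using hecke_module hecke_class_closed[OF assms(1)] hecke_class_closed[OF assms(2)]
  unfolding left_module_def hecke_class_simps(2)[OF assms] by blast

lemma act_class_mult:
  assumes "f \<in> carrier (free_algebra S)" "g \<in> carrier (free_algebra S)"
  shows "act (cl (f * g)) x = act (cl f) (act (cl g) x)"
  using hecke_module hecke_class_closed[OF assms(1)] hecke_class_closed[OF assms(2)]
  unfolding left_module_def hecke_class_simps(1)[OF assms] by blast

lemma scal_class: "sc a x = act (cl (free_const a)) x"
  by (simp add: scal_def hecke_const_def hecke_class_def)

lemma T_class: "T s x = act (cl (free_word [s])) x"
  by (simp add: hecke_T_def hecke_class_def)

text \<open>Scalars act through constants of the Hecke algebra, so the module laws are instances of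
  those for \<open>act\<close>.\<close>

sublocale M: Modules.module "scal W S act"
proof
  show "sc a (x + y) = sc a x + sc a y" for a x y
    unfolding scal_class by (intro act_right_add hecke_class_closed free_const_closed)
  show "sc (a + a') x = sc a x + sc a' x" for a a' x
    unfolding scal_class free_const_simps by (intro act_class_add free_const_closed)
  show "sc a (sc a' x) = sc (a * a') x" for a a' x
    unfolding scal_class free_const_simps by (intro act_class_mult[symmetric] free_const_closed)
  show "sc 1 x = x" for x
    unfolding scal_class free_const_simps by (simp add: hecke_class_simps act_one)
qed

lemma T_add: "s \<in> S \<Longrightarrow> T s (x + y) = T s x + T s y"
  unfolding T_class by (intro act_right_add hecke_class_closed free_word_closed) auto

lemma T_scal:
  assumes "s \<in> S"
  shows "T s (sc a x) = sc a (T s x)"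
  using assms unfolding T_class scal_class
  by (simp add: free_const_closed free_word_closed free_const_commute flip: act_class_mult)

lemma T_zero: "s \<in> S \<Longrightarrow> T s 0 = 0"
  using T_add[of s 0 0] by simp

lemma T_sum: "s \<in> S \<Longrightarrow> T s (sum f A) = (\<Sum>x\<in>A. T s (f x))"
  by (induction A rule: infinite_finite_induct) (auto simp: T_add T_zero)

text \<open>The bar of \<open>T_s\<close> is its inverse, which equals
  \<open>T_s - (q - q^-1)\<close> by \<open>inv_hecke_T\<close>.\<close>

lemma mbar_T:
  assumes "s \<in> S"
  shows "mbar (T s x) = T s (mbar x) - sc (qq - qinv) (mbar x)"
proof -
  note T = free_word_closed[of "[s]" S] and c = free_const_closed[of "qq - qinv" S]
  have Tc: "free_word [s] - free_const (qq - qinv) \<in> carrier (free_algebra S)"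
    using T c assms by (intro free_algebra_minus_closed) auto
  have "hecke_T W S s \<in> carrier (hecke_algebra W S)"
    using assms hecke_class_closed[OF T] by (simp add: hecke_T_def hecke_class_def)
  then have "mbar (T s x) = act (hbar (hecke_T W S s)) (mbar x)" by (rule mbar_act)
  also have "\<dots> = act (cl (free_word [s] - free_const (qq - qinv))) (mbar x)"
    using hbar assms by (simp add: hecke_involution_def inv_hecke_T)
  finally have "mbar (T s x) = act (cl (free_word [s] - free_const (qq - qinv))) (mbar x)" .
  moreover have "T s (mbar x) = act (cl (free_word [s] - free_const (qq - qinv))) (mbar x)
      + sc (qq - qinv) (mbar x)"
    unfolding T_class scal_class using Tc c by (simp flip: act_class_add)
  ultimately show ?thesis by simp
qed

section \<open>Coordinates in the basis C\<close>

text \<open>\<open>representation\<close> is indexed by basis vectors; here the index is the group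
  element labelling the vector.\<close>

definition coeff :: "'w \<Rightarrow> 'm \<Rightarrow> laurent" where
  "coeff w x = M.representation (c ` I) x (c w)"

lemma in_span_c: "x \<in> M.span (c ` I)"
  by (simp add: c_span)

lemma coeff_add: "coeff w (x + y) = coeff w x + coeff w y"
  unfolding coeff_def by (simp add: M.representation_add[OF c_independent in_span_c in_span_c])

lemma coeff_diff: "coeff w (x - y) = coeff w x - coeff w y"
  unfolding coeff_def by (simp add: M.representation_diff[OF c_independent in_span_c in_span_c])

lemma coeff_scal: "coeff w (sc a x) = a * coeff w x"
  unfolding coeff_def by (simp add: M.representation_scale[OF c_independent in_span_c])

lemma coeff_zero: "coeff w 0 = 0"
  unfolding coeff_def by (simp add: M.representation_zero)

lemma coeff_sum: "coeff w (sum f A) = (\<Sum>x\<in>A. coeff w (f x))"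
  by (induction A rule: infinite_finite_induct) (auto simp: coeff_add coeff_zero)

lemmas coeff_simps = coeff_add coeff_diff coeff_scal coeff_zero coeff_sum

lemma coeff_c:
  assumes "w \<in> I" "y \<in> I"
  shows "coeff w (c y) = (if y = w then 1 else 0)"
  using assms c_inj unfolding coeff_def
  by (auto simp: M.representation_basis[OF c_independent] inj_on_def)

text \<open>The vectors \<open>c y\<close> are bar-invariant, so the semilinear involution acts on
  coordinates by \<open>laurent_bar\<close>.\<close>

lemma coeff_mbar:
  assumes "w \<in> I"
  shows "coeff w (mbar x) = laurent_bar (coeff w x)"
proof -
  have zero: "laurent_bar 0 = 0"
    by (rule poly_mapping_eqI) (simp add: lookup_laurent_bar)
  from in_span_c show ?thesis
  proof (induction x rule: M.span_induct_alt)
    case base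
    have "mbar 0 = 0" using mbar_add[of 0 0] by simp
    then show ?case by (simp add: coeff_zero zero)
  next
    case (step a x y)
    then show ?case
      using assms
      by (auto simp: mbar_add mbar_scal mbar_c coeff_simps coeff_c laurent_bar_add zero)
  qed
qed

section \<open>Elements of the ideal, their suffixes and triangularity by length\<close>

lemma I_subset: "I \<subseteq> carrier W"
  using ideal by (simp add: weak_order_ideal_def)

abbreviation len :: "'w \<Rightarrow> nat" where "len \<equiv> cox_length W S"

text \<open>\<open>b u\<close> is \<open>c u\<close> plus a combination of vectors
  \<open>c y\<close> with \<open>y\<close> shorter than \<open>u\<close>. Comparing lengths is
  enough here and in what follows, in place of finer Bruhat comparisons.\<close>

lemma coeff_b:
  assumes "w \<in> I" "u \<in> I" "len u \<le> len w"
  shows "coeff w (b u) = (if u = w then 1 else 0)"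
proof -
  have "coeff w (c y) = 0" if "y \<in> I" "bruhat_less W S y u" for y
    using that assms bruhat_less_cox_length[of y u] by (auto simp: coeff_c)
  then show ?thesis using assms by (auto simp: b_eq coeff_simps coeff_c)
qed

lemma SA_closed: "s \<in> SA W S I u \<Longrightarrow> s \<otimes> u \<in> I"
  by (simp add: SA_def)

text \<open>The quotient of \<open>w\<close> by \<open>v\<close> is the generator \<open>s\<close>,
  of length 1, so \<open>v\<close> is a suffix of \<open>w\<close>.\<close>

lemma suffix_closed:
  assumes "w \<in> I" "s \<in> S" "v \<in> carrier W" "w = s \<otimes> v" "len w = Suc (len v)"
  shows "v \<in> I"
proof -
  have "s \<in> carrier W" using assms S_carrier by auto
  then have "w \<otimes> inv v = s" using assms by (simp add: m_assoc)
  then have "left_weak_le W S v w"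
    using assms by (simp add: left_weak_le_def cox_length_generator)
  then show ?thesis using ideal assms by (auto simp: weak_order_ideal_def)
qed

lemma SD_closed:
  assumes "u \<in> I" "s \<in> SD W S u"
  shows "s \<otimes> u \<in> I"
proof -
  have s: "s \<in> S" "s \<in> carrier W" "u \<in> carrier W" "len (s \<otimes> u) < len u"
    using assms S_carrier I_subset bruhat_less_cox_length by (auto simp: SD_def)
  then have "len u = Suc (len (s \<otimes> u))"
    using cox_length_generator_mult_le[of s "s \<otimes> u"] by (simp add: generator_mult_generator_mult)
  then show ?thesis
    using suffix_closed[OF assms(1) s(1), of "s \<otimes> u"] s by (simp add: generator_mult_generator_mult)
qed

text \<open>Right multiplication by any element of \<open>J\<close> lengthens every element of the
  ideal. This later rules out that \<open>s\<close> is a weak descent of \<open>v\<close> when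
  \<open>s \<otimes> v\<close> lies in the ideal.\<close>

lemma min_coset_rep: "w \<in> I \<Longrightarrow> w \<in> min_coset_reps W S J"
  using I_subset J_subset by (auto simp: min_coset_reps_def Pos_def)

section \<open>The coordinate at \<open>c w\<close> after applying \<open>T s\<close>\<close>

text \<open>\<open>T s (b u)\<close> involves at most \<open>b (s \<otimes> u)\<close>,
  \<open>b u\<close> and some \<open>b y\<close> with \<open>y\<close> below
  \<open>s \<otimes> u\<close>. As \<open>u\<close> is shorter than \<open>w\<close> and
  \<open>s \<otimes> u\<close> is not longer, only \<open>b (s \<otimes> u)\<close> with
  \<open>s \<otimes> u = w\<close>, that is \<open>u = v\<close>, can contribute. Outside the case
  SA, \<open>u = v\<close> is impossible: \<open>s \<otimes> u\<close> would be too short, outside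
  D_J, or outside the ideal.\<close>

lemma coeff_T_b:
  assumes w: "w \<in> I" "v \<in> I" "s \<in> S" "w = s \<otimes> v" and u: "u \<in> I" "len u < len w"
  shows "coeff w (T s (b u)) = (if u = v then 1 else 0)"
proof -
  have inj: "s \<otimes> u = w \<longleftrightarrow> u = v"
    using w u I_subset S_carrier by (metis generator_mult_generator_mult subsetD)
  have len: "len (s \<otimes> u) \<le> len w"
    using cox_length_generator_mult_le[of s u] w u I_subset by auto
  have neq: "u \<noteq> w" using u by auto
  from w(3) subsetD[OF I_subset u(1)] I_subset show ?thesis
  proof (cases rule: generator_cases[where J = J and w = u])
    case SA
    then show ?thesis
      using w(1) u(1) len inj T_SA[OF u(1) SA] SA_closed[OF SA] by (simp add: coeff_b)
  next
    case SD
    then have "len (s \<otimes> u) < len u" by (simp add: SD_def bruhat_less_cox_length)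
    then have "u \<noteq> v" using u w(4) by auto
    then show ?thesis
      using SD w u len inj neq SD_closed by (simp add: T_SD coeff_simps coeff_b)
  next
    case WD
    then have "u \<noteq> v" using w min_coset_rep by (auto simp: WD_def)
    then show ?thesis
      using T_WD[OF u(1) WD] w(1) u neq by (simp add: coeff_scal coeff_b del: M.scale_minus_left)
  next
    case WA
    then have "s \<otimes> u \<notin> I" by (simp add: WA_def)
    then have "u \<noteq> v" using w by auto
    obtain r where r: "T s (b u) = sc qq (b u) - (\<Sum>y | y \<in> I \<and> bruhat_less W S y (s \<otimes> u). sc (r y) (b y))"
      using T_WA[OF u(1) WA] by auto
    \<comment> \<open>Here \<open>len y < len (s \<otimes> u) \<le> len w\<close>, so these terms
      vanish whatever the coefficients \<open>r y\<close> are.\<close>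
    have "coeff w (b y) = 0" if "y \<in> I" "bruhat_less W S y (s \<otimes> u)" for y
      using that bruhat_less_cox_length[of y "s \<otimes> u"] len w by (auto simp: coeff_b)
    then show ?thesis using r \<open>u \<noteq> v\<close> w u neq by (simp add: coeff_simps coeff_b)
  qed
qed

text \<open>Strong induction on the length of \<open>u\<close>: the terms by which
  \<open>b u\<close> differs from \<open>c u\<close> contribute nothing, so the value is the one
  from \<open>coeff_T_b\<close>.\<close>

lemma coeff_T_c:
  assumes w: "w \<in> I" "v \<in> I" "s \<in> S" "w = s \<otimes> v" "len w = Suc (len v)"
    and u: "u \<in> I" "len u < len w"
  shows "coeff w (T s (c u)) = (if u = v then 1 else 0)"
  using u
proof (induction "len u" arbitrary: u rule: less_induct)
  case less
  let ?Y = "{y. y \<in> I \<and> bruhat_less W S y u}"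
  \<comment> \<open>Since \<open>len w\<close> exceeds \<open>len v\<close> by exactly one,
    \<open>len y < len u \<le> len v\<close>. Hence \<open>y\<close> is not \<open>v\<close>, and
    the induction hypothesis gives 0.\<close>
  have "coeff w (T s (c y)) = 0" if "y \<in> ?Y" for y
  proof -
    from that have "y \<in> I" "len y < len u" using bruhat_less_cox_length by auto
    then show ?thesis using less w(5) by (auto simp: less.hyps)
  qed
  moreover have "coeff w (T s (b u)) = coeff w (T s (c u)) + qq * (\<Sum>y\<in>?Y. p y u * coeff w (T s (c y)))"
    using w less.prems by (simp add: b_eq T_add T_scal T_sum coeff_simps)
  ultimately show ?case using coeff_T_b[OF w(1-4) less.prems] by simp
qed

lemma const_term_p_suffix:
  assumes w: "w \<in> I" "v \<in> I" "s \<in> S" "w = s \<otimes> v" "len w = Suc (len v)"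
  shows "const_term (p v w) = 1"
proof -
  let ?Y = "{y. y \<in> I \<and> bruhat_less W S y w}"
  define g where "g = coeff w (T s (c w))"
  have carr: "v \<in> carrier W" "w \<in> carrier W" using w I_subset by auto
  have less: "bruhat_less W S v w"
    using bruhat_less_generator_mult[OF w(3) carr(1)] w by simp
  have sw: "s \<otimes> w = v" using w carr by (simp add: generator_mult_generator_mult)
  have "s \<in> SD W S w" using less sw w by (simp add: SD_def)
  then have "T s (b w) = b v + sc (qq - qinv) (b w)" using T_SD[OF w(1)] sw by simp
  \<comment> \<open>\<open>v\<close> is shorter than \<open>w\<close>, so \<open>b v\<close>
    contributes nothing, while \<open>b w\<close> has coordinate 1.\<close>
  then have "coeff w (T s (b w)) = qq - qinv"
    using w by (auto simp: coeff_simps coeff_b)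
  moreover have "coeff w (T s (b w)) = g + qq * (\<Sum>y\<in>?Y. p y w * coeff w (T s (c y)))"
    using w by (simp add: b_eq T_add T_scal T_sum coeff_simps g_def)
  \<comment> \<open>By \<open>coeff_T_c\<close> only \<open>y = v\<close> survives; the sum stays
    unevaluated until \<open>?Y\<close> is known to be finite.\<close>
  moreover have "(\<Sum>y\<in>?Y. p y w * coeff w (T s (c y))) = (\<Sum>y\<in>?Y. if y = v then p v w else 0)"
  proof (rule sum.cong)
    fix y assume "y \<in> ?Y"
    then show "p y w * coeff w (T s (c y)) = (if y = v then p v w else 0)"
      using coeff_T_c[OF w] bruhat_less_cox_length by simp
  qed simp
  ultimately have g: "g = qq - qinv - qq * (\<Sum>y\<in>?Y. if y = v then p v w else 0)"
    by (simp add: eq_diff_eq)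
  \<comment> \<open>This is \<open>mbar_T\<close> at the bar-invariant vector \<open>c w\<close>,
    read off at coordinate \<open>w\<close>.\<close>
  have bar: "laurent_bar g = g - (qq - qinv)"
    using w by (simp add: mbar_T mbar_c coeff_simps coeff_c g_def flip: coeff_mbar)
  have look: "Poly_Mapping.lookup qq k = (if k = 1 then 1 else 0)"
     "Poly_Mapping.lookup qinv k = (if k = -1 then 1 else 0)" for k
    by (auto simp: qq_def qinv_def lookup_single when_def)
  \<comment> \<open>A sum over an infinite set is 0 by convention, and then \<open>g\<close> and \<open>bar\<close> are contradictory.\<close>
  have "finite ?Y"
  proof (rule ccontr)
    assume "infinite ?Y"
    then have "g = qq - qinv" using g by simp
    with bar have "laurent_bar (qq - qinv) = 0" by simp
    then have "Poly_Mapping.lookup (laurent_bar (qq - qinv)) 1 = 0" by simp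
    then show False by (simp add: lookup_laurent_bar lookup_minus look)
  qed
  then have g': "g = qq - qinv - qq * p v w" using g w less by simp
  \<comment> \<open>Both sides of \<open>bar\<close> are compared at exponent 1. The left side is
    the coefficient of \<open>g\<close> at -1; multiplication by \<open>qq\<close> shifts exponents,
    so it is -1 minus the coefficient of \<open>p v w\<close> at -2, which vanishes. The right side
    is minus the constant term of \<open>p v w\<close>.\<close>
  have "Poly_Mapping.lookup (p v w) (-2) = 0"
    using p_Aplus[OF w(2,1) less] by (force simp: Aplus_def in_keys_iff)
  moreover have "Poly_Mapping.lookup (laurent_bar g) 1 = Poly_Mapping.lookup (g - (qq - qinv)) 1"
    using bar by simp
  ultimately show ?thesis
    unfolding const_term_def g' by (simp add: lookup_laurent_bar lookup_minus look lookup_qq_mult)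
qed

section \<open>Arrows of the W-graph leading down from \<open>c \<one>\<close>\<close>

text \<open>The generator \<open>s\<close> separates the two descent sets:
  \<open>s \<otimes> w = v\<close> is below \<open>w\<close>, whereas
  \<open>s \<otimes> v = w\<close> is above \<open>v\<close> and lies in D_J, so \<open>s\<close> is
  neither a strong nor a weak descent of \<open>v\<close>.\<close>

lemma wg_arrow_suffix:
  assumes w: "w \<in> I" "v \<in> I" "s \<in> S" "w = s \<otimes> v" "len w = Suc (len v)"
  shows "wg_arrow (W_graph_of W S I J c p) (c w) (c v)"
proof -
  have carr: "v \<in> carrier W" "w \<in> carrier W" using w I_subset by auto
  have less: "bruhat_less W S v w"
    using bruhat_less_generator_mult[OF w(3) carr(1)] w by simp
  have not_less: "\<not> bruhat_less W S w v"
    using bruhat_less_cox_length[of w v] w(5) by auto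
  have "s \<in> Desc W S J w"
    using less w carr by (simp add: Desc_def SD_def generator_mult_generator_mult)
  moreover have "s \<notin> Desc W S J v"
    using not_less min_coset_rep[OF w(1)] w(4) by (simp add: Desc_def SD_def WD_def)
  ultimately have "\<not> Desc W S J w \<subseteq> Desc W S J v" by blast
  \<comment> \<open>At the pair \<open>c w\<close>, \<open>c v\<close> the definition of
    \<open>mu\<close> takes its second branch, because \<open>v\<close> is below \<open>w\<close>;
    the value is the constant term of \<open>p v w\<close>, namely 1.\<close>
  then show ?thesis
    using less not_less w(1,2) const_term_p_suffix[OF w] c_inj
    by (simp add: wg_arrow_def W_graph_of_def the_inv_into_f_f)
qed

text \<open>Stripping left descents leads from \<open>w\<close> to the identity; every intermediate
  element is a suffix, hence in the ideal, and every strip is an arrow.\<close>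

lemma wg_le_one:
  assumes "w \<in> I"
  shows "wg_le (W_graph_of W S I J c p) (c w) (c \<one>)"
  using assms
proof (induction "len w" arbitrary: w rule: less_induct)
  case less
  show ?case
  proof (cases "w = \<one>")
    case True
    then show ?thesis by (simp add: wg_le_def)
  next
    case False
    then obtain s v where v: "s \<in> S" "v \<in> carrier W" "w = s \<otimes> v" "len w = Suc (len v)"
      using left_descent less.prems I_subset by blast
    then have "v \<in> I" using suffix_closed less.prems by blast
    with v less have "wg_arrow (W_graph_of W S I J c p) (c w) (c v)"
        "wg_le (W_graph_of W S I J c p) (c v) (c \<one>)"
      using wg_arrow_suffix by auto
    then show ?thesis
      unfolding wg_le_def by (rule converse_rtranclp_into_rtranclp)
  qed
qed

end

section \<open>Cells and their partial order\<close>

lemma wg_le_trans: "wg_le \<Gamma> u v \<Longrightarrow> wg_le \<Gamma> v x \<Longrightarrow> wg_le \<Gamma> u x"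
  unfolding wg_le_def by (rule rtranclp_trans)

lemma equiv_wg_equiv: "equiv (verts \<Gamma>) (wg_equiv \<Gamma>)"
proof (rule equivI)
  show "wg_equiv \<Gamma> \<subseteq> verts \<Gamma> \<times> verts \<Gamma>" by (auto simp: wg_equiv_def)
  show "refl_on (verts \<Gamma>) (wg_equiv \<Gamma>)" by (auto simp: wg_equiv_def wg_le_def refl_on_def)
  show "sym (wg_equiv \<Gamma>)" by (auto simp: wg_equiv_def sym_def)
  show "trans (wg_equiv \<Gamma>)"
    unfolding trans_def wg_equiv_def by (blast intro: wg_le_trans)
qed

text \<open>A vertex above all others makes its cell the greatest one, and a greatest element of a
  partial order is its only maximal element.\<close>

lemma greatest_cell:
  assumes "C\<^sub>1 \<in> wg_cells \<Gamma>" "v \<in> C\<^sub>1" and le: "\<And>u. u \<in> verts \<Gamma> \<Longrightarrow> wg_le \<Gamma> u v"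
  shows "maximal_cell \<Gamma> C\<^sub>1 \<and> (\<forall>C. maximal_cell \<Gamma> C \<longrightarrow> C = C\<^sub>1)"
proof -
  have cell: "x \<in> verts \<Gamma>" "wg_le \<Gamma> x y" if "C \<in> wg_cells \<Gamma>" "x \<in> C" "y \<in> C" for C x y
    using quotient_eq_iff[OF equiv_wg_equiv, of C _ C x y] that
    by (auto simp: wg_cells_def wg_equiv_def)
  have "C = C\<^sub>1" if C: "C \<in> wg_cells \<Gamma>" "cell_le \<Gamma> C\<^sub>1 C" for C
  proof -
    from C obtain u x where ux: "u \<in> C\<^sub>1" "x \<in> C" "wg_le \<Gamma> u x"
      unfolding cell_le_def by blast
    \<comment> \<open>Antisymmetry on cells: \<open>v\<close> is below \<open>x\<close> by way of
      \<open>u\<close>, and \<open>x\<close> is below \<open>v\<close> by assumption, so the two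
      cells share a class.\<close>
    have "wg_le \<Gamma> v x" using cell(2)[OF assms(1,2) ux(1)] ux(3) by (rule wg_le_trans)
    moreover have "v \<in> verts \<Gamma>" "x \<in> verts \<Gamma>" using cell(1) assms(1,2) C(1) ux(2) by blast+
    ultimately have "(x, v) \<in> wg_equiv \<Gamma>" by (simp add: wg_equiv_def le)
    then show ?thesis
      using quotient_eqI[OF equiv_wg_equiv _ _ ux(2) assms(2)] C(1) assms(1) unfolding wg_cells_def by blast
  qed
  \<comment> \<open>Cells are nonempty, so each has a vertex below \<open>v\<close>. Every cell
    therefore lies below the cell of \<open>v\<close>, and a maximal one must coincide with
    it.\<close>
  moreover have "cell_le \<Gamma> C C\<^sub>1" if "C \<in> wg_cells \<Gamma>" for C
  proof -
    from that obtain x where "x \<in> C"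
      using in_quotient_imp_non_empty[OF equiv_wg_equiv] unfolding wg_cells_def by blast
    then show ?thesis using that assms cell unfolding cell_le_def by blast
  qed
  ultimately show ?thesis using assms(1) unfolding maximal_cell_def by blast
qed

theorem lemma4p5:
  fixes W :: "('w, 'r) monoid_scheme"
    and S I J :: "'w set"
    and hbar :: "'w free_alg set \<Rightarrow> 'w free_alg set"
    and act :: "'w free_alg set \<Rightarrow> 'm \<Rightarrow> 'm :: ab_group_add"
    and b c :: "'w \<Rightarrow> 'm"
    and mbar :: "'m \<Rightarrow> 'm"
    and p :: "'w \<Rightarrow> 'w \<Rightarrow> laurent"
    and \<Gamma> :: "('m, 'w) wgraph"
    and C1 :: "'m set"
  assumes "coxeter_system W S"
    and "hecke_involution W S hbar"
    and "weak_order_ideal W S I" and "I \<noteq> {}" and "J \<subseteq> Pos W S I"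
    and "W_graph_ideal W S I J hbar act b mbar"
    and "W_graph_basis W S I act b mbar c p"
    and "\<Gamma> = W_graph_of W S I J c p"
    and "C1 \<in> wg_cells \<Gamma>" and "c \<one>\<^bsub>W\<^esub> \<in> C1"
  shows "maximal_cell \<Gamma> C1 \<and> (\<forall>C. maximal_cell \<Gamma> C \<longrightarrow> C = C1)"
proof -
  interpret W_graph_ideal_basis W S I J hbar act b mbar c p
    using assms by (simp add: W_graph_ideal_basis_def W_graph_ideal_basis_axioms_def)
  show ?thesis
  proof (rule greatest_cell)
    fix u assume "u \<in> verts \<Gamma>"
    then show "wg_le \<Gamma> u (c \<one>\<^bsub>W\<^esub>)" using assms(8) wg_le_one by (auto simp: W_graph_of_def)
  qed fact+
qed

end
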